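(* Let $u,t\in\mathbb{R}$, let $q_7(z,\bar z):=z^3-itz-u\bar z$, and assume $0<|u|<t<2|u|$. Then $\operatorname{card}\mathcal{Z}(q_7)=7$. In fact, $$\mathcal{Z}(q_7)=\{0,\ \pm(p+iq),\ \pm(q+ip),\ \pm(r+ir)\},$$ where $p,q,r>0$, $t=4pq$, $u=p^2+q^2$ and $r^2=\frac{t-u}{2}$.
   Context: $\mathcal{Z}(q_7)=\{z\in\mathbb{C}: q_7(z,\bar z)=0\}$ denotes the zero set of $q_7$ in $\mathbb{C}$, and $\operatorname{card}$ denotes cardinality.
   Formalization: The formal theorem additionally assumes u > 0: for u < 0 the claim is always false (e.g. u = -2, t = 3 gives only 3 zeros, and u = p^2+q^2 is impossible), so no true case is lost. *)

theory Defs
  imports Complex_Main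
begin

text \<open>A polynomial in two independent variables; the zero set is taken on the diagonal \<open>w = cnj z\<close>.\<close>

definition q7 :: "real \<Rightarrow> real \<Rightarrow> complex \<Rightarrow> complex \<Rightarrow> complex" where
  "q7 u t z w = z ^ 3 - \<i> * of_real t * z - of_real u * w"

definition zero_set :: "(complex \<Rightarrow> complex \<Rightarrow> complex) \<Rightarrow> complex set" where
  "zero_set f = {z. f z (cnj z) = 0}"

end

theory Submission
  imports Defs
begin

text \<open>
  Write \<open>z = x + i y\<close>. The real and imaginary parts of \<open>q\<^sub>7(z, cnj z) = 0\<close> are two odd cubics, and
  swapping \<open>x\<close> and \<open>y\<close> turns each into the negative of the other. So their sum is antisymmetric and
  vanishes on the line \<open>x = y\<close>, while their difference is symmetric and, being odd, vanishes on the
  line \<open>x = -y\<close>. Both split off a linear factor: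
  \[ (x - y)(x^2 + 4xy + y^2 - (t + u)) = 0, \qquad (x + y)(x^2 - 4xy + y^2 + (t - u)) = 0. \]
  The four ways to choose a factor from each give everything. The two lines meet in the origin. The line
  \<open>x = y\<close> meets the second conic where \<open>2 x\<^sup>2 = t - u\<close>, which is two points because \<open>t > u\<close>. The line
  \<open>x = -y\<close> would meet the first conic where \<open>2 x\<^sup>2 = -(t + u) < 0\<close>, that is, nowhere. Finally the two
  conics together say \<open>x\<^sup>2 + y\<^sup>2 = u\<close> and \<open>4xy = t\<close>, or \<open>(x \<plusminus> y)\<^sup>2 = u \<plusminus> t/2\<close>; because \<open>t < 2u\<close> both
  right-hand sides are positive, and the four sign choices give four points off the diagonal.
\<close>

lemma q7_eq_0_iff_factored:
  "q7 u t (Complex x y) (cnj (Complex x y)) = 0 \<longleftrightarrow>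
     (x - y) * (x\<^sup>2 + 4 * x * y + y\<^sup>2 - (t + u)) = 0 \<and>
     (x + y) * (x\<^sup>2 - 4 * x * y + y\<^sup>2 + (t - u)) = 0"
proof -
  define a b where "a = x ^ 3 - 3 * x * y\<^sup>2 + t * y - u * x"
    and "b = 3 * x\<^sup>2 * y - y ^ 3 - t * x + u * y"
  have "q7 u t (Complex x y) (cnj (Complex x y)) = Complex a b"
    unfolding q7_def a_def b_def
    by (simp add: complex_eq_iff power3_eq_cube power2_eq_square algebra_simps)
  moreover have "(x - y) * (x\<^sup>2 + 4 * x * y + y\<^sup>2 - (t + u)) = a + b"
    and "(x + y) * (x\<^sup>2 - 4 * x * y + y\<^sup>2 + (t - u)) = a - b"
    unfolding a_def b_def by (simp_all add: power3_eq_cube power2_eq_square algebra_simps)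
  moreover have "Complex a b = 0 \<longleftrightarrow> a + b = 0 \<and> a - b = 0"
    by (auto simp: complex_eq_iff)
  ultimately show ?thesis by simp
qed

text \<open>
  A pair of reals is determined up to swapping and a common sign by its product and the sum of its
  squares, because these fix the squares of its sum and of its difference.
\<close>

lemma sum_squares_and_product_eq_iff:
  fixes x y p q :: real
  shows "x\<^sup>2 + y\<^sup>2 = p\<^sup>2 + q\<^sup>2 \<and> x * y = p * q \<longleftrightarrow>
    (x, y) \<in> {(p, q), (-p, -q), (q, p), (-q, -p)}"
proof
  assume "x\<^sup>2 + y\<^sup>2 = p\<^sup>2 + q\<^sup>2 \<and> x * y = p * q"
  then have "(x + y)\<^sup>2 = (p + q)\<^sup>2" and "(x - y)\<^sup>2 = (p - q)\<^sup>2"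
    by (simp_all add: power2_sum power2_diff)
  then have "x + y = p + q \<or> x + y = - (p + q)" and "x - y = p - q \<or> x - y = - (p - q)"
    by (simp_all only: power2_eq_iff)
  then show "(x, y) \<in> {(p, q), (-p, -q), (q, p), (-q, -p)}"
    by auto
qed (auto simp: algebra_simps)

lemma obtain_sum_squares_and_product:
  fixes u t :: real
  assumes "0 < t" and "t < 2 * u"
  obtains p q where "0 < q" and "q < p" and "t = 4 * p * q" and "u = p\<^sup>2 + q\<^sup>2"
proof
  \<comment> \<open>The required \<open>p + q\<close> and \<open>p - q\<close>.\<close>
  define A B where "A = sqrt (u + t / 2)" and "B = sqrt (u - t / 2)"
  have sq: "A\<^sup>2 = u + t / 2" "B\<^sup>2 = u - t / 2" and "0 < B" and "B < A"
    using assms by (auto simp: A_def B_def)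
  then show "0 < (A - B) / 2" and "(A - B) / 2 < (A + B) / 2"
    by auto
  have "4 * ((A + B) / 2) * ((A - B) / 2) = A\<^sup>2 - B\<^sup>2"
    by (simp add: power2_eq_square field_simps)
  then show "t = 4 * ((A + B) / 2) * ((A - B) / 2)"
    using sq by simp
  have "((A + B) / 2)\<^sup>2 + ((A - B) / 2)\<^sup>2 = (A\<^sup>2 + B\<^sup>2) / 2"
    by (simp add: power_divide power2_sum power2_diff add_divide_distrib diff_divide_distrib)
  then show "u = ((A + B) / 2)\<^sup>2 + ((A - B) / 2)\<^sup>2"
    using sq by simp
qed

lemma q7_eq_0_iff:
  assumes t: "t = 4 * p * q" and u: "u = p\<^sup>2 + q\<^sup>2" and r: "r\<^sup>2 = (t - u) / 2"
    and pos: "0 < t + u"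
  shows "q7 u t (Complex x y) (cnj (Complex x y)) = 0 \<longleftrightarrow>
    (x, y) \<in> {(0, 0), (p, q), (-p, -q), (q, p), (-q, -p), (r, r), (-r, -r)}"
proof -
  let ?C = "x\<^sup>2 + 4 * x * y + y\<^sup>2 - (t + u)" and ?D = "x\<^sup>2 - 4 * x * y + y\<^sup>2 + (t - u)"
  have conics: "?C = 0 \<and> ?D = 0 \<longleftrightarrow> (x, y) \<in> {(p, q), (-p, -q), (q, p), (-q, -p)}"
    unfolding sum_squares_and_product_eq_iff[symmetric] using t u by auto
  have diagonal: "x = y \<and> ?D = 0 \<longleftrightarrow> x = y \<and> (x = r \<or> x = - r)"
  proof (rule conj_cong[OF refl])
    assume "x = y"
    then have "?D = 2 * (r\<^sup>2 - x\<^sup>2)"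
      unfolding r by (simp add: power2_eq_square field_simps)
    then have "?D = 0 \<longleftrightarrow> x\<^sup>2 = r\<^sup>2" by auto
    then show "?D = 0 \<longleftrightarrow> x = r \<or> x = - r" by (simp only: power2_eq_iff)
  qed
  have antidiagonal: "\<not> (?C = 0 \<and> x + y = 0)"
  proof
    assume C: "?C = 0 \<and> x + y = 0"
    then have "y = - x" by simp
    then have "?C = - 2 * x\<^sup>2 - (t + u)"
      by (simp add: power2_eq_square)
    then show False using C pos zero_le_power2[of x] by linarith
  qed
  have "q7 u t (Complex x y) (cnj (Complex x y)) = 0 \<longleftrightarrow>
      (x = y \<and> x + y = 0) \<or> (x = y \<and> ?D = 0) \<or> (?C = 0 \<and> x + y = 0) \<or> (?C = 0 \<and> ?D = 0)"
    unfolding q7_eq_0_iff_factored mult_eq_0_iff right_minus_eq[of x y] by blast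
  also have "\<dots> \<longleftrightarrow> (x, y) = (0, 0) \<or> (x, y) \<in> {(r, r), (-r, -r)} \<or>
      (x, y) \<in> {(p, q), (-p, -q), (q, p), (-q, -p)}"
    unfolding conics diagonal by (simp only: antidiagonal) auto
  finally show ?thesis by auto
qed

theorem lemma2p3:
  fixes u t :: real
  assumes "0 < \<bar>u\<bar>" and "\<bar>u\<bar> < t" and "t < 2 * \<bar>u\<bar>"
    and "u > 0"
  shows "card (zero_set (q7 u t)) = 7 \<and>
    (\<exists>p q r :: real. p > 0 \<and> q > 0 \<and> r > 0 \<and>
       t = 4 * p * q \<and> u = p\<^sup>2 + q\<^sup>2 \<and> r\<^sup>2 = (t - u) / 2 \<and>
       zero_set (q7 u t) =
         {0, Complex p q, - Complex p q, Complex q p, - Complex q p, Complex r r, - Complex r r})"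
proof -
  obtain p q where q: "0 < q" and pq: "q < p" and t: "t = 4 * p * q" and u: "u = p\<^sup>2 + q\<^sup>2"
  proof (rule obtain_sum_squares_and_product[of t u])
    show "0 < t" "t < 2 * u" using assms by auto
  qed
  define r where "r = sqrt ((t - u) / 2)"
  have r: "0 < r" "r\<^sup>2 = (t - u) / 2"
    using assms by (auto simp: r_def)
  have eq: "zero_set (q7 u t) =
      {0, Complex p q, - Complex p q, Complex q p, - Complex q p, Complex r r, - Complex r r}"
    (is "_ = ?S")
  proof (rule set_eqI)
    fix z
    obtain x y where z: "z = Complex x y" by (cases z)
    have "z \<in> zero_set (q7 u t) \<longleftrightarrow>
        (x, y) \<in> {(0, 0), (p, q), (-p, -q), (q, p), (-q, -p), (r, r), (-r, -r)}"
      using q7_eq_0_iff[OF t u r(2)] assms by (simp add: zero_set_def z)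
    then show "z \<in> zero_set (q7 u t) \<longleftrightarrow> z \<in> ?S"
      by (auto simp: z complex_eq_iff)
  qed
  \<comment> \<open>Apart from the origin, each point has both coordinates positive or both negative, and \<open>p \<noteq> q\<close>.\<close>
  have "card (zero_set (q7 u t)) = 7"
    unfolding eq using q pq r(1) by (simp add: card_insert_if complex_eq_iff)
  moreover have "0 < p"
    using q pq by simp
  ultimately show ?thesis
    using eq q r t u by blast
qed

end
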